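(* Let $N,K\ge 1$ be integers, $P>0$, $\sigma_v^2>0$, $\lambda>0$, $0<d\le \lambda/2$, let $\alpha_1,\dots,\alpha_K\in\mathbb{C}\setminus\{0\}$, $\theta_1,\dots,\theta_K\in[-\pi/2,\pi/2]$, and let $s=(s_1,\dots,s_K)$ be a vector of symbols from an $M$-ary PSK constellation, so that $|s_i|=1$ for all $i$. Let $a(\theta)=[1,\,e^{-\mathfrak{j}\frac{2\pi d}{\lambda}\sin\theta},\dots,e^{-\mathfrak{j}(N-1)\frac{2\pi d}{\lambda}\sin\theta}]^T\in\mathbb{C}^N$, where $\mathfrak{j}=\sqrt{-1}$, and let $A\in\mathbb{C}^{K\times N}$ be the matrix whose $i$th row is $a(\theta_i)^T$; assume that $A$ has full row rank, and let $A^\dagger=A^H(AA^H)^{-1}$. For $i=1,\dots,K$ define $$\sigma_{w,i}^2=\frac{4|\alpha_i|^2P}{3}\left|\sin\left(\frac{\pi d}{\lambda}\sin\theta_i\right)\right|^2+\sigma_v^2,\qquad \sigma_{w,i}>0,$$ and let $D=\mathrm{Diag}(\sigma_{w,1}\alpha_1^*/|\alpha_1|^2,\dots,\sigma_{w,K}\alpha_K^*/|\alpha_K|^2)$. Let $$\gamma=\frac{1}{\|A^\dagger D s\|_{IQ-\infty}},\qquad \mathsf{SNR}_{\mathsf{eff},i}=\frac{P}{2N}\gamma^2,\quad i=1,\dots,K .$$ Let $k=\arg\max_{i=1,\dots,K}\sigma_{w,i}/|\alpha_i|$ and $R=AA^H/N$, and let $\lambda_{\min}(R)$ denote the smallest eigenvalue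 of $R$. Then for all $i=1,\dots,K$, $$\mathsf{SNR}_{\mathsf{eff},i}\;\ge\;\frac{PN|\alpha_k|^2\lambda_{\min}^2(R)}{2K^3\sigma_{w,k}^2}\;=\;\frac{PN|\alpha_k|^2\lambda_{\min}^2(R)}{2K^3\left(\frac{4|\alpha_k|^2P}{3}\left|\sin\left(\frac{\pi d}{\lambda}\sin\theta_k\right)\right|^2+\sigma_v^2\right)}.$$ Moreover, $$1\ge\lambda_{\min}(R)\ge 1-(K-1)\rho,\qquad \rho=\max_{i\ne j}\left|D_N\left(\frac{\pi d}{\lambda}(\sin\theta_i-\sin\theta_j)\right)\right|,$$ where $D_N(\phi)=\sin(N\phi)/(N\sin\phi)$ is the digital sinc function.
   Context: For $x\in\mathbb{C}^N$, $\|x\|_{IQ-\infty}=\max\{|\Re(x_1)|,|\Im(x_1)|,\dots,|\Re(x_N)|,|\Im(x_N)|\}$. The function $D_N$ is extended by continuity at points where $\sin\phi=0$ (so $|D_N|=1$ there), and $\rho=0$ if $K=1$. $^*$ is complex conjugation and $^H$ conjugate transpose. Interpretation: $\bar{x}=\gamma A^\dagger D s$ is the zero-forcing precoded signal, normalized so that $\|\bar x\|_{IQ-\infty}=1$; user $i$ receives $y_i=\sqrt{P/(2N)}\,\alpha_i a(\theta_i)^T\bar x+w_i=c_is_i+w_i$ with $c_i=\sqrt{P/(2N)}\,\gamma\,\sigma_{w,i}$ and noise $w_i$ of variance $\sigma_{w,i}^2$, so that $\mathsf{SNR}_{\mathsf{eff},i}=c_i^2/\sigma_{w,i}^2=\frac{P}{2N}\gamma^2$.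 *)

theory Defs
  imports
    "Jordan_Normal_Form.Spectral_Radius"
    "Jordan_Normal_Form.Schur_Decomposition"
    "Jordan_Normal_Form.Gauss_Jordan_Elimination"
    "Jordan_Normal_Form.DL_Rank"
begin

text \<open>Vector and matrix indices start at 0.\<close>

definition steering_vec :: "nat \<Rightarrow> real \<Rightarrow> real \<Rightarrow> real \<Rightarrow> complex vec" where
  "steering_vec N d wl \<theta> =
     vec N (\<lambda>n. exp (- \<i> * complex_of_real (real n * (2 * pi * d / wl) * sin \<theta>)))"

definition steering_mat :: "nat \<Rightarrow> nat \<Rightarrow> real \<Rightarrow> real \<Rightarrow> (nat \<Rightarrow> real) \<Rightarrow> complex mat" where
  "steering_mat K N d wl \<theta> = mat_of_rows N (map (\<lambda>i. steering_vec N d wl (\<theta> i)) [0..<K])"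

text \<open>The value \<^term>\<open>the (mat_inverse M)\<close> is the inverse of \<^term>\<open>M\<close> only if \<^term>\<open>M\<close> is
  invertible; for \<open>M = A A\<^sup>H\<close> this is the case when \<^term>\<open>A\<close> has full row rank.\<close>

definition right_pinv :: "complex mat \<Rightarrow> complex mat" where
  "right_pinv A = mat_adjoint A * the (mat_inverse (A * mat_adjoint A))"

definition iq_norm :: "complex vec \<Rightarrow> real" where
  "iq_norm x = Max (\<Union>n<dim_vec x. {\<bar>Re (x $ n)\<bar>, \<bar>Im (x $ n)\<bar>})"

text \<open>The phase offset \<^term>\<open>\<phi>\<close> covers both usual conventions, \<open>\<phi> = 0\<close> and \<open>\<phi> = \<pi> / M\<close>.\<close>

definition psk :: "nat \<Rightarrow> real \<Rightarrow> complex set" where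
  "psk M \<phi> = {cis (\<phi> + 2 * pi * real m / real M) | m. m < M}"

text \<open>Intended for Hermitian matrices, whose eigenvalues are real (\<open>hermitian_eigenvalue_real\<close>
  below), so that taking real parts only changes the type.\<close>

definition lambda_min :: "complex mat \<Rightarrow> real" where
  "lambda_min R = Min (Re ` spectrum R)"

text \<open>At the zeros of \<^term>\<open>sin\<close> the value is the one given by l'Hospital's rule;
  \<open>isCont_digital_sinc\<close> below shows that this is the continuous extension.\<close>

definition digital_sinc :: "nat \<Rightarrow> real \<Rightarrow> real" where
  "digital_sinc N \<phi> =
     (if sin \<phi> = 0 then cos (real N * \<phi>) / cos \<phi>
      else sin (real N * \<phi>) / (real N * sin \<phi>))"

lemma isCont_digital_sinc:
  assumes "N \<ge> 1"
  shows "isCont (digital_sinc N) \<phi>"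
proof (cases "sin \<phi> = 0")
  case False
  have "\<forall>\<^sub>F t in nhds \<phi>. sin t \<noteq> 0"
    using False tendsto_imp_eventually_ne[OF isContD[OF isCont_sin] False]
    by (simp add: eventually_nhds_conv_at)
  then have "\<forall>\<^sub>F t in nhds \<phi>. digital_sinc N t = sin (real N * t) / (real N * sin t)"
    by eventually_elim (simp add: digital_sinc_def)
  moreover have "isCont (\<lambda>t. sin (real N * t) / (real N * sin t)) \<phi>"
    using False assms by (intro continuous_intros) auto
  ultimately show ?thesis
    by (simp add: isCont_cong)
next
  case True
  then obtain i :: int where i: "\<phi> = real_of_int i * pi"
    by (auto simp: sin_zero_iff_int2)
  have sN: "sin (real N * \<phi>) = 0"
    unfolding sin_zero_iff_int2 i by (rule exI[of _ "int N * i"]) simp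
  have c0: "cos \<phi> \<noteq> 0"
    using True sin_cos_squared_add[of \<phi>] by auto
  have "((\<lambda>t. sin (real N * t)) has_real_derivative real N * cos (real N * \<phi>)) (at \<phi>)"
    by (auto intro!: derivative_eq_intros)
  then have 1: "((\<lambda>t. sin (real N * t) / (t - \<phi>)) \<longlongrightarrow> real N * cos (real N * \<phi>)) (at \<phi>)"
    by (simp add: has_field_derivative_iff sN)
  have "((\<lambda>t. real N * sin t) has_real_derivative real N * cos \<phi>) (at \<phi>)"
    by (auto intro!: derivative_eq_intros)
  then have 2: "((\<lambda>t. real N * sin t / (t - \<phi>)) \<longlongrightarrow> real N * cos \<phi>) (at \<phi>)"
    by (simp add: has_field_derivative_iff True)
  have "real N * cos \<phi> \<noteq> 0"
    using c0 assms by simp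
  with 2 have ne: "\<forall>\<^sub>F t in at \<phi>. real N * sin t / (t - \<phi>) \<noteq> 0"
    by (rule tendsto_imp_eventually_ne)
  have "((\<lambda>t. (sin (real N * t) / (t - \<phi>)) / (real N * sin t / (t - \<phi>))) \<longlongrightarrow>
          (real N * cos (real N * \<phi>)) / (real N * cos \<phi>)) (at \<phi>)"
    using c0 assms by (intro tendsto_divide 1 2) simp
  moreover have "(real N * cos (real N * \<phi>)) / (real N * cos \<phi>) = digital_sinc N \<phi>"
    using True assms by (simp add: digital_sinc_def)
  moreover have "\<forall>\<^sub>F t in at \<phi>. (sin (real N * t) / (t - \<phi>)) / (real N * sin t / (t - \<phi>)) = digital_sinc N t"
    using ne by eventually_elim (auto simp: digital_sinc_def)
  ultimately have "(digital_sinc N \<longlongrightarrow> digital_sinc N \<phi>) (at \<phi>)"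
    by (auto intro: Lim_transform_eventually)
  then show ?thesis
    by (simp add: isCont_def)
qed

lemma hermitian_eigenvalue_real:
  fixes R :: "complex mat"
  assumes "R \<in> carrier_mat n n" "mat_adjoint R = R" "eigenvalue R \<mu>"
  shows "complex_of_real (Re \<mu>) = \<mu>"
proof -
  obtain v where v: "v \<in> carrier_vec n" "v \<noteq> 0\<^sub>v n" "R *\<^sub>v v = \<mu> \<cdot>\<^sub>v v"
    using assms unfolding eigenvalue_def eigenvector_def by auto
  have herm: "cnj (R $$ (i, j)) = R $$ (j, i)" if "i < n" "j < n" for i j
  proof -
    have "mat_adjoint R $$ (j, i) = cnj (R $$ (i, j))"
      using assms(1) that by (simp add: mat_adjoint_def mat_of_rows_def)
    then show ?thesis
      by (simp add: assms(2))
  qed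
  define S where "S = (\<Sum>i<n. \<Sum>j<n. R $$ (i, j) * v $ j * cnj (v $ i))"
  define q where "q = (\<Sum>i<n. (cmod (v $ i))\<^sup>2)"
  have row: "(\<Sum>j<n. R $$ (i, j) * v $ j) = \<mu> * v $ i" if "i < n" for i
  proof -
    have "(R *\<^sub>v v) $ i = (\<Sum>j<n. R $$ (i, j) * v $ j)"
      using assms(1) v(1) that by (simp add: scalar_prod_def atLeast0LessThan)
    then show ?thesis
      using v that by simp
  qed
  have "S = (\<Sum>i<n. (\<Sum>j<n. R $$ (i, j) * v $ j) * cnj (v $ i))"
    by (simp add: S_def sum_distrib_right)
  also have "\<dots> = (\<Sum>i<n. \<mu> * (v $ i * cnj (v $ i)))"
    using row by (intro sum.cong) (simp_all add: mult.assoc)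
  also have "\<dots> = \<mu> * complex_of_real q"
    by (simp add: q_def sum_distrib_left complex_norm_square del: of_real_power)
  finally have S: "S = \<mu> * complex_of_real q" .
  have "cnj S = (\<Sum>i<n. \<Sum>j<n. R $$ (j, i) * cnj (v $ j) * v $ i)"
    unfolding S_def using herm by (simp add: cnj_sum)
  also have "\<dots> = S"
    unfolding S_def by (subst sum.swap) (simp add: ac_simps)
  finally have "cnj \<mu> * complex_of_real q = \<mu> * complex_of_real q"
    using S by simp
  moreover have "q \<noteq> 0"
  proof
    assume "q = 0"
    then have "\<forall>i<n. v $ i = 0"
      by (simp add: q_def sum_nonneg_eq_0_iff)
    then have "v = 0\<^sub>v n"
      using v(1) by (intro eq_vecI) auto
    with v(2) show False ..
  qed
  ultimately have "cnj \<mu> = \<mu>"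
    by simp
  then show ?thesis
    by (simp add: complex_eq_iff)
qed

end

theory Submission
  imports Defs "HOL-Analysis.L2_Norm"
begin

text \<open>Put \<open>G = A A\<^sup>H = N R\<close>, \<open>z = D s\<close> and \<open>w = G\<^sup>-\<^sup>1 z\<close>, so that the unnormalized precoded signal is
  \<open>A\<^sup>H w\<close>. As \<open>A\<close> has unimodular entries, Cauchy--Schwarz bounds each entry of \<open>A\<^sup>H w\<close> by \<open>\<surd>K \<parallel>w\<parallel>\<close>;
  the Rayleigh bound for \<open>R\<close> gives \<open>N \<lambda>\<^sub>m\<^sub>i\<^sub>n(R) \<parallel>w\<parallel> \<le> \<parallel>z\<parallel>\<close>, and \<open>\<parallel>z\<parallel> \<le> \<surd>K \<sigma>\<^sub>k / |\<alpha>\<^sub>k|\<close>. This even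
  yields \<open>K\<^sup>2\<close> in place of \<open>K\<^sup>3\<close>. The bounds on \<open>\<lambda>\<^sub>m\<^sub>i\<^sub>n(R)\<close> come from the unit diagonal of \<open>R\<close>, through
  the Rayleigh quotient of a unit vector and Gershgorin's theorem: the off-diagonal entries of \<open>R\<close>
  are geometric sums of modulus \<open>|D\<^sub>N|\<close>.\<close>

section \<open>Squared Euclidean norm and Cauchy--Schwarz\<close>

definition vnorm2 :: "complex vec \<Rightarrow> real" where
  "vnorm2 v = (\<Sum>i<dim_vec v. (cmod (v $ i))\<^sup>2)"

lemma vnorm2_nonneg [simp]: "0 \<le> vnorm2 v"
  by (simp add: vnorm2_def sum_nonneg)

lemma cscalar_prod_self: "v \<bullet>c v = complex_of_real (vnorm2 v)"
  by (simp add: vnorm2_def scalar_prod_def atLeast0LessThan complex_norm_square del: of_real_power)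

lemma vnorm2_eq_0_iff:
  assumes "v \<in> carrier_vec n"
  shows "vnorm2 v = 0 \<longleftrightarrow> v = 0\<^sub>v n"
  using conjugate_square_eq_0_vec[OF assms] by (simp add: cscalar_prod_self)

text \<open>Reduces to the real inequality for \<open>L2_set\<close>, applied to the moduli of the
  entries. The product is the bilinear one because entries of a matrix-vector product have that
  form; the sesquilinear case follows by conjugating \<open>v\<close>.\<close>

lemma cmod_scalar_prod_le:
  assumes "dim_vec u = dim_vec v"
  shows "(cmod (u \<bullet> v))\<^sup>2 \<le> vnorm2 u * vnorm2 v"
proof -
  have "cmod (u \<bullet> v) \<le> (\<Sum>i<dim_vec v. cmod (u $ i) * cmod (v $ i))"
    unfolding scalar_prod_def atLeast0LessThan
    by (rule order_trans[OF norm_sum]) (simp add: norm_mult)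
  then have "(cmod (u \<bullet> v))\<^sup>2 \<le> (\<Sum>i<dim_vec v. cmod (u $ i) * cmod (v $ i))\<^sup>2"
    by (intro power_mono) auto
  also have "\<dots> \<le> (L2_set (\<lambda>i. cmod (u $ i)) {..<dim_vec v} * L2_set (\<lambda>i. cmod (v $ i)) {..<dim_vec v})\<^sup>2"
    using L2_set_mult_ineq[of "\<lambda>i. cmod (u $ i)" "\<lambda>i. cmod (v $ i)" "{..<dim_vec v}"]
    by (intro power_mono) (auto intro: sum_nonneg)
  also have "\<dots> = vnorm2 u * vnorm2 v"
    by (simp add: L2_set_def vnorm2_def assms power_mult_distrib sum_nonneg)
  finally show ?thesis .
qed

lemma vnorm2_conjugate [simp]: "vnorm2 (conjugate v) = vnorm2 v"
  by (simp add: vnorm2_def)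

lemma Re_cscalar_prod_le:
  assumes "dim_vec u = dim_vec v"
  shows "(Re (u \<bullet>c v))\<^sup>2 \<le> vnorm2 u * vnorm2 v"
proof -
  have "(Re (u \<bullet>c v))\<^sup>2 \<le> (cmod (u \<bullet>c v))\<^sup>2"
    using abs_Re_le_cmod[of "u \<bullet>c v"] by (simp add: abs_le_square_iff[symmetric])
  also have "\<dots> \<le> vnorm2 u * vnorm2 v"
    using cmod_scalar_prod_le[of u "conjugate v"] assms by simp
  finally show ?thesis .
qed

section \<open>The conjugate transpose\<close>

lemma index_mat_adjoint:
  fixes A :: "complex mat"
  assumes "i < dim_col A" "j < dim_row A"
  shows "mat_adjoint A $$ (i, j) = cnj (A $$ (j, i))"
  using assms by (simp add: mat_adjoint_def mat_of_rows_def)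

lemma dim_mat_adjoint [simp]:
  fixes A :: "complex mat"
  shows "dim_row (mat_adjoint A) = dim_col A" "dim_col (mat_adjoint A) = dim_row A"
  by (simp_all add: mat_adjoint_def)

lemma mat_adjoint_carrier [simp]:
  fixes A :: "complex mat"
  assumes "A \<in> carrier_mat m n"
  shows "mat_adjoint A \<in> carrier_mat n m"
  using assms by (intro carrier_matI) auto

lemma cscalar_prod_adjoint:
  fixes A :: "complex mat"
  assumes A: "A \<in> carrier_mat m n" and x: "x \<in> carrier_vec n" and y: "y \<in> carrier_vec m"
  shows "(A *\<^sub>v x) \<bullet>c y = x \<bullet>c (mat_adjoint A *\<^sub>v y)"
proof -
  have "(A *\<^sub>v x) \<bullet>c y = (\<Sum>i<m. \<Sum>j<n. A $$ (i, j) * x $ j * cnj (y $ i))"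
    using assms by (simp add: scalar_prod_def atLeast0LessThan sum_distrib_right)
  also have "\<dots> = (\<Sum>j<n. \<Sum>i<m. A $$ (i, j) * x $ j * cnj (y $ i))"
    by (rule sum.swap)
  also have "\<dots> = x \<bullet>c (mat_adjoint A *\<^sub>v y)"
    using assms
    by (simp add: scalar_prod_def atLeast0LessThan index_mat_adjoint sum_distrib_left cnj_sum ac_simps)
  finally show ?thesis .
qed

section \<open>The smallest eigenvalue as a lower bound of the quadratic form\<close>

lemma vnorm2_mult_mat_vec_bounded:
  fixes A :: "complex mat"
  assumes A: "A \<in> carrier_mat m n"
  obtains C where "C > 0" "\<And>x. x \<in> carrier_vec n \<Longrightarrow> vnorm2 (A *\<^sub>v x) \<le> C * vnorm2 x"
proof
  \<comment> \<open>The squared Frobenius norm, from Cauchy--Schwarz in each row. Adding 1 keeps the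
    constant positive even for the zero matrix, since such constants later appear in
    denominators.\<close>
  define C where "C = (\<Sum>i<m. vnorm2 (row A i)) + 1"
  show "C > 0"
    by (simp add: C_def add_nonneg_pos sum_nonneg)
  fix x :: "complex vec"
  assume x: "x \<in> carrier_vec n"
  have "vnorm2 (A *\<^sub>v x) = (\<Sum>i<m. (cmod (row A i \<bullet> x))\<^sup>2)"
    using A by (simp add: vnorm2_def)
  also have "\<dots> \<le> (\<Sum>i<m. vnorm2 (row A i) * vnorm2 x)"
    using A x by (intro sum_mono cmod_scalar_prod_le) auto
  also have "\<dots> \<le> C * vnorm2 x"
    by (simp add: C_def sum_distrib_right distrib_right)
  finally show "vnorm2 (A *\<^sub>v x) \<le> C * vnorm2 x" .
qed

text \<open>Positivity of the quadratic form at \<open>w - H w / C\<close> gives the claim.\<close>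

lemma vnorm2_le_psd_form:
  fixes H :: "complex mat"
  assumes H: "H \<in> carrier_mat n n" and herm: "mat_adjoint H = H"
    and psd: "\<And>x. x \<in> carrier_vec n \<Longrightarrow> 0 \<le> Re ((H *\<^sub>v x) \<bullet>c x)"
    and C: "C > 0" "\<And>x. x \<in> carrier_vec n \<Longrightarrow> vnorm2 (H *\<^sub>v x) \<le> C\<^sup>2 * vnorm2 x"
    and w: "w \<in> carrier_vec n"
  shows "vnorm2 (H *\<^sub>v w) \<le> C * Re ((H *\<^sub>v w) \<bullet>c w)"
proof -
  define g where "g = H *\<^sub>v w"
  define t :: complex where "t = complex_of_real (1 / C)"
  have g: "g \<in> carrier_vec n"
    using H w by (simp add: g_def)
  have Hg: "H *\<^sub>v g \<in> carrier_vec n"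
    using H g by simp
  \<comment> \<open>Self-adjointness moves \<open>H\<close> onto \<open>w\<close>, so both cross
    terms in the expansion below have the real part \<open>vnorm2 g\<close>.\<close>
  have Hgw: "(H *\<^sub>v g) \<bullet>c w = complex_of_real (vnorm2 g)"
    using cscalar_prod_adjoint[OF H g w] herm by (simp add: g_def[symmetric] cscalar_prod_self)
  have "(Re ((H *\<^sub>v g) \<bullet>c g))\<^sup>2 \<le> vnorm2 (H *\<^sub>v g) * vnorm2 g"
    using g Hg by (intro Re_cscalar_prod_le) (metis carrier_vecD)
  also have "\<dots> \<le> (C * vnorm2 g)\<^sup>2"
    using mult_right_mono[OF C(2)[OF g], of "vnorm2 g"] by (simp add: power2_eq_square ac_simps)
  finally have Hgg: "Re ((H *\<^sub>v g) \<bullet>c g) \<le> C * vnorm2 g"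
    by (rule power2_le_imp_le) (use C(1) in simp)
  have "(H *\<^sub>v (w - t \<cdot>\<^sub>v g)) = g - t \<cdot>\<^sub>v (H *\<^sub>v g)"
    using H w g by (simp add: mult_minus_distrib_mat_vec mult_mat_vec g_def)
  moreover have "conjugate (w - t \<cdot>\<^sub>v g) = conjugate w - t \<cdot>\<^sub>v conjugate g"
    using w g by (intro eq_vecI) (auto simp: t_def)
  ultimately have "(H *\<^sub>v (w - t \<cdot>\<^sub>v g)) \<bullet>c (w - t \<cdot>\<^sub>v g) =
      g \<bullet>c w - t * (g \<bullet>c g) - t * ((H *\<^sub>v g) \<bullet>c w) + t * t * ((H *\<^sub>v g) \<bullet>c g)"
    using w g Hg
    by (simp add: minus_scalar_prod_distrib[of _ n] scalar_prod_minus_distrib[of _ n] algebra_simps)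
  then have "Re ((H *\<^sub>v (w - t \<cdot>\<^sub>v g)) \<bullet>c (w - t \<cdot>\<^sub>v g)) =
      Re (g \<bullet>c w) - 2 / C * vnorm2 g + 1 / C\<^sup>2 * Re ((H *\<^sub>v g) \<bullet>c g)"
    unfolding Hgw cscalar_prod_self by (simp add: t_def power2_eq_square)
  \<comment> \<open>The last term is at most \<open>vnorm2 g / C\<close>, which cancels half of the
    cross terms.\<close>
  also have "\<dots> \<le> Re (g \<bullet>c w) - 2 / C * vnorm2 g + 1 / C\<^sup>2 * (C * vnorm2 g)"
    using Hgg by (intro add_left_mono mult_left_mono) auto
  also have "\<dots> = Re (g \<bullet>c w) - vnorm2 g / C"
    using C(1) by (simp add: field_simps power2_eq_square)
  finally have "vnorm2 g / C \<le> Re (g \<bullet>c w)"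
    using psd[of "w - t \<cdot>\<^sub>v g"] w g by simp
  then show ?thesis
    using C(1) by (simp add: g_def field_simps)
qed

text \<open>A nonzero determinant makes \<open>A\<close> a unit of the matrix ring, and
  \<open>mat_inverse\<close> returns \<open>None\<close> only for non-units.\<close>

lemma det_nonzero_inverse:
  fixes A :: "'a :: field mat"
  assumes "A \<in> carrier_mat n n" "det A \<noteq> 0"
  obtains B where "mat_inverse A = Some B" "B \<in> carrier_mat n n" "A * B = 1\<^sub>m n" "B * A = 1\<^sub>m n"
proof -
  have "A \<in> Units (ring_mat TYPE('a) n undefined)"
    using assms by (rule det_non_zero_imp_unit)
  then obtain B where "mat_inverse A = Some B"
    using mat_inverse(1)[OF assms(1), of undefined] by (cases "mat_inverse A") auto
  with mat_inverse(2)[OF assms(1)] show thesis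
    by (intro that) auto
qed

text \<open>The best lower bound \<open>m\<close> of the quadratic form is attained at an eigenvalue: otherwise
  \<open>R - m I\<close> is positive semidefinite and invertible, and then its form dominates a positive multiple
  of the squared norm.\<close>

lemma hermitian_rayleigh:
  fixes R :: "complex mat"
  assumes R: "R \<in> carrier_mat n n" and herm: "mat_adjoint R = R" and n: "n > 0"
  obtains m :: real where "eigenvalue R (complex_of_real m)"
    "\<And>w. w \<in> carrier_vec n \<Longrightarrow> m * vnorm2 w \<le> Re ((R *\<^sub>v w) \<bullet>c w)"
proof -
  define q where "q w = Re ((R *\<^sub>v w) \<bullet>c w)" for w
  define S where "S = {m. \<forall>w\<in>carrier_vec n. m * vnorm2 w \<le> q w}"
  define m where "m = Sup S"
  obtain C where C: "C > 0" "\<And>x. x \<in> carrier_vec n \<Longrightarrow> vnorm2 (R *\<^sub>v x) \<le> C * vnorm2 x"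
    using vnorm2_mult_mat_vec_bounded[OF R] by blast
  \<comment> \<open>Boundedness of \<open>R\<close> and Cauchy--Schwarz provide one lower bound of
    the form, so \<open>S\<close> is nonempty.\<close>
  have "- sqrt C * vnorm2 w \<le> q w" if w: "w \<in> carrier_vec n" for w
  proof -
    have "(q w)\<^sup>2 \<le> vnorm2 (R *\<^sub>v w) * vnorm2 w"
      unfolding q_def using R w by (intro Re_cscalar_prod_le) auto
    also have "\<dots> \<le> (sqrt C * vnorm2 w)\<^sup>2"
      using mult_right_mono[OF C(2)[OF w], of "vnorm2 w"] C(1)
      by (simp add: power_mult_distrib real_sqrt_pow2) (simp add: power2_eq_square ac_simps)
    finally have "\<bar>q w\<bar> \<le> sqrt C * vnorm2 w"
      using C(1) by (simp add: abs_le_square_iff[symmetric])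
    then show ?thesis
      by simp
  qed
  then have S_ne: "- sqrt C \<in> S"
    by (simp add: S_def)
  \<comment> \<open>The Rayleigh quotient of any nonzero vector bounds \<open>S\<close> above; a
    unit vector is available because \<open>n > 0\<close>.\<close>
  define e where "e = (unit_vec n 0 :: complex vec)"
  have e: "e \<in> carrier_vec n" "vnorm2 e > 0"
  proof -
    show "e \<in> carrier_vec n"
      by (simp add: e_def)
    then have "vnorm2 e \<noteq> 0"
      using vnorm2_eq_0_iff[of e n] n by (simp add: e_def unit_vec_nonzero)
    then show "vnorm2 e > 0"
      using vnorm2_nonneg[of e] by linarith
  qed
  have S_le: "m' \<le> q w / vnorm2 w" if "m' \<in> S" "w \<in> carrier_vec n" "vnorm2 w > 0" for m' w
    using that by (auto simp: S_def field_simps)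
  have bdd: "bdd_above S"
    using S_le e by (intro bdd_aboveI) blast
  \<comment> \<open>The supremum is itself a member of \<open>S\<close>: each Rayleigh quotient is
    an upper bound of \<open>S\<close>, hence at least \<open>m\<close>.\<close>
  have m: "m * vnorm2 w \<le> q w" if w: "w \<in> carrier_vec n" for w
  proof (cases "vnorm2 w = 0")
    case True
    then show ?thesis
      using S_ne w by (auto simp: S_def)
  next
    case False
    then have pos: "vnorm2 w > 0"
      using vnorm2_nonneg[of w] by linarith
    have "m \<le> q w / vnorm2 w"
      unfolding m_def using S_ne S_le[OF _ w pos] by (intro cSup_least) auto
    then show ?thesis
      using pos by (simp add: field_simps)
  qed
  define H where "H = R - complex_of_real m \<cdot>\<^sub>m 1\<^sub>m n"
  have H: "H \<in> carrier_mat n n"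
    unfolding H_def by (intro minus_carrier_mat) simp
  have Hherm: "mat_adjoint H = H"
  proof (rule eq_matI)
    fix i j
    assume "i < dim_row H" "j < dim_col H"
    then have ij: "i < n" "j < n"
      using H by auto
    then have "cnj (R $$ (j, i)) = R $$ (i, j)"
      using index_mat_adjoint[of i R j] R herm by simp
    then show "mat_adjoint H $$ (i, j) = H $$ (i, j)"
      using ij R H by (auto simp: index_mat_adjoint) (auto simp: H_def)
  qed (use H in auto)
  have Hx: "H *\<^sub>v x = R *\<^sub>v x - complex_of_real m \<cdot>\<^sub>v x" if "x \<in> carrier_vec n" for x
    proof -
    have "(complex_of_real m \<cdot>\<^sub>m 1\<^sub>m n) *\<^sub>v x = complex_of_real m \<cdot>\<^sub>v x"
      using that by (intro eq_vecI) auto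
    then show ?thesis
      using that R by (simp add: H_def minus_mult_distrib_mat_vec[of _ n n])
  qed
  have Hq: "Re ((H *\<^sub>v x) \<bullet>c x) = q x - m * vnorm2 x" if x: "x \<in> carrier_vec n" for x
    using x R by (simp add: Hx minus_scalar_prod_distrib[of _ n] cscalar_prod_self q_def)
  have "det H = 0"
  proof (rule ccontr)
    assume "det H \<noteq> 0"
    then obtain B where B: "B \<in> carrier_mat n n" "B * H = 1\<^sub>m n"
      using det_nonzero_inverse[OF H] by metis
    obtain E where E: "E > 0" "\<And>x. x \<in> carrier_vec n \<Longrightarrow> vnorm2 (B *\<^sub>v x) \<le> E * vnorm2 x"
      using vnorm2_mult_mat_vec_bounded[OF B(1)] by blast
    obtain F where F: "F > 0" "\<And>x. x \<in> carrier_vec n \<Longrightarrow> vnorm2 (H *\<^sub>v x) \<le> F * vnorm2 x"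
      using vnorm2_mult_mat_vec_bounded[OF H] by blast
    \<comment> \<open>Writing \<open>w = B (H w)\<close> bounds \<open>vnorm2 w\<close> by
      \<open>E * vnorm2 (H w)\<close>, and the estimate for positive semidefinite forms, with
      constant \<open>sqrt F\<close>, bounds that by a multiple of the form of \<open>H\<close>. The
      bound \<open>m\<close> could then be raised, against its choice as a supremum.\<close>
    have "m + 1 / (E * sqrt F) \<in> S"
      unfolding S_def
    proof (intro CollectI ballI)
      fix w :: "complex vec"
      assume w: "w \<in> carrier_vec n"
      have "vnorm2 w = vnorm2 (B *\<^sub>v (H *\<^sub>v w))"
        using assoc_mult_mat_vec[OF B(1) H w] B(2) w by simp
      also have "\<dots> \<le> E * vnorm2 (H *\<^sub>v w)"
        using H w by (intro E(2)) auto
      also have "vnorm2 (H *\<^sub>v w) \<le> sqrt F * Re ((H *\<^sub>v w) \<bullet>c w)"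
        using F m Hq by (intro vnorm2_le_psd_form[OF H Hherm _ _ _ w]) auto
      finally have "vnorm2 w \<le> E * (sqrt F * (q w - m * vnorm2 w))"
        using E(1) Hq[OF w] by simp
      then show "(m + 1 / (E * sqrt F)) * vnorm2 w \<le> q w"
        using E(1) F(1) by (simp add: field_simps)
    qed
    then have "m + 1 / (E * sqrt F) \<le> m"
      unfolding m_def using bdd by (rule cSup_upper)
    moreover have "1 / (E * sqrt F) > 0"
      using E(1) F(1) by simp
    ultimately show False
      by linarith
  qed
  \<comment> \<open>A kernel vector of the shifted matrix \<open>H\<close> is an eigenvector of
    \<open>R\<close> for \<open>m\<close>.\<close>
  then obtain v where v: "v \<in> carrier_vec n" "v \<noteq> 0\<^sub>v n" "H *\<^sub>v v = 0\<^sub>v n"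
    using det_0_iff_vec_prod_zero_field[OF H] by blast
  have "R *\<^sub>v v = complex_of_real m \<cdot>\<^sub>v v"
  proof (rule eq_vecI)
    fix i
    assume "i < dim_vec (complex_of_real m \<cdot>\<^sub>v v)"
    then have i: "i < n"
      using v by simp
    have "(R *\<^sub>v v - complex_of_real m \<cdot>\<^sub>v v) $ i = 0"
      using v i Hx[OF v(1)] by simp
    then show "(R *\<^sub>v v) $ i = (complex_of_real m \<cdot>\<^sub>v v) $ i"
      using v R i by simp
  qed (use R v in auto)
  then have "eigenvalue R (complex_of_real m)"
    using v R unfolding eigenvalue_def eigenvector_def by auto
  then show thesis
    using m by (intro that) (auto simp: q_def)
qed

lemma lambda_min_le:
  assumes "R \<in> carrier_mat n n" "eigenvalue R \<mu>"
  shows "lambda_min R \<le> Re \<mu>"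
  unfolding lambda_min_def using card_finite_spectrum(1)[OF assms(1)] assms(2)
  by (intro Min_le) (auto simp: spectrum_def)

lemma lambda_min_eigenvalue:
  assumes "R \<in> carrier_mat n n" "n > 0"
  obtains \<mu> where "eigenvalue R \<mu>" "lambda_min R = Re \<mu>"
proof -
  have "lambda_min R \<in> Re ` spectrum R"
    unfolding lambda_min_def using card_finite_spectrum(1)[OF assms(1)] spectrum_non_empty[OF assms]
    by (intro Min_in) auto
  then show thesis
    using that by (auto simp: spectrum_def)
qed

text \<open>The bound of \<open>hermitian_rayleigh\<close> is an eigenvalue, so
  \<open>lambda_min R\<close> lies below it and inherits the inequality.\<close>

lemma lambda_min_rayleigh:
  fixes R :: "complex mat"
  assumes "R \<in> carrier_mat n n" "mat_adjoint R = R" "n > 0" "w \<in> carrier_vec n"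
  shows "lambda_min R * vnorm2 w \<le> Re ((R *\<^sub>v w) \<bullet>c w)"
proof -
  obtain m :: real where m: "eigenvalue R (complex_of_real m)"
      "\<And>w. w \<in> carrier_vec n \<Longrightarrow> m * vnorm2 w \<le> Re ((R *\<^sub>v w) \<bullet>c w)"
    using hermitian_rayleigh[OF assms(1-3)] by metis
  have "lambda_min R * vnorm2 w \<le> m * vnorm2 w"
    using lambda_min_le[OF assms(1) m(1)] by (intro mult_right_mono) auto
  with m(2)[OF assms(4)] show ?thesis
    by linarith
qed

text \<open>Takes the place of a norm bound on the inverse of \<open>R\<close>. The Rayleigh bound
  is squared, which is where nonnegativity of \<open>lambda_min R\<close> enters, then combined with
  Cauchy--Schwarz, and one factor \<open>vnorm2 w\<close> is cancelled.\<close>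

lemma lambda_min_mult_vnorm2_le:
  fixes R :: "complex mat"
  assumes R: "R \<in> carrier_mat n n" "mat_adjoint R = R" "n > 0" and "w \<in> carrier_vec n"
    and "0 \<le> lambda_min R"
  shows "(lambda_min R)\<^sup>2 * vnorm2 w \<le> vnorm2 (R *\<^sub>v w)"
proof (cases "vnorm2 w = 0")
  case False
  have "(lambda_min R * vnorm2 w)\<^sup>2 \<le> (Re ((R *\<^sub>v w) \<bullet>c w))\<^sup>2"
    using assms by (intro power_mono lambda_min_rayleigh) auto
  also have "\<dots> \<le> vnorm2 (R *\<^sub>v w) * vnorm2 w"
    using assms by (intro Re_cscalar_prod_le) auto
  finally have "((lambda_min R)\<^sup>2 * vnorm2 w) * vnorm2 w \<le> vnorm2 (R *\<^sub>v w) * vnorm2 w"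
    by (simp add: power_mult_distrib power2_eq_square ac_simps)
  then show ?thesis
    using False vnorm2_nonneg[of w] by (auto simp: mult_le_cancel_right)
qed simp

text \<open>Gershgorin's argument in a row where the eigenvector has an entry of maximal modulus.\<close>

lemma eigenvalue_ge_of_unit_diagonal:
  fixes R :: "complex mat"
  assumes R: "R \<in> carrier_mat n n" and "eigenvalue R \<mu>"
    and diag: "\<And>i. i < n \<Longrightarrow> R $$ (i, i) = 1"
    and off: "\<And>i j. i < n \<Longrightarrow> j < n \<Longrightarrow> i \<noteq> j \<Longrightarrow> cmod (R $$ (i, j)) \<le> \<rho>"
  shows "1 - (real n - 1) * \<rho> \<le> Re \<mu>"
proof -
  obtain v where v: "v \<in> carrier_vec n" "v \<noteq> 0\<^sub>v n" "R *\<^sub>v v = \<mu> \<cdot>\<^sub>v v"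
    using assms unfolding eigenvalue_def eigenvector_def by auto
  then obtain l where l: "l < n" "v $ l \<noteq> 0"
    by (metis carrier_vecD eq_vecI index_zero_vec)
  have "Max ((\<lambda>j. cmod (v $ j)) ` {..<n}) \<in> (\<lambda>j. cmod (v $ j)) ` {..<n}"
    using l(1) by (intro Max_in) auto
  then obtain i where i: "i < n" and "cmod (v $ i) = Max ((\<lambda>j. cmod (v $ j)) ` {..<n})"
    by auto
  then have i_max: "cmod (v $ j) \<le> cmod (v $ i)" if "j < n" for j
    using that by simp
  have pos: "cmod (v $ i) > 0"
    using i_max[OF l(1)] l(2) by (auto intro: less_le_trans)
  have "(R *\<^sub>v v) $ i = (\<Sum>j<n. R $$ (i, j) * v $ j)"
    using R v(1) i by (simp add: scalar_prod_def atLeast0LessThan)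
  then have "\<mu> * v $ i = (\<Sum>j<n. R $$ (i, j) * v $ j)"
    using v i by simp
  also have "\<dots> = v $ i + (\<Sum>j\<in>{..<n} - {i}. R $$ (i, j) * v $ j)"
    using i by (subst sum.remove[of _ i]) (auto simp: diag)
  finally have "cmod ((1 - \<mu>) * v $ i) = cmod (\<Sum>j\<in>{..<n} - {i}. R $$ (i, j) * v $ j)"
    by (simp add: algebra_simps norm_minus_commute)
  also have "\<dots> \<le> (\<Sum>j\<in>{..<n} - {i}. cmod (R $$ (i, j)) * cmod (v $ j))"
    by (rule order_trans[OF norm_sum]) (simp add: norm_mult)
  also have "\<dots> \<le> (\<Sum>j\<in>{..<n} - {i}. \<rho> * cmod (v $ i))"
  proof (rule sum_mono)
    fix j
    assume j: "j \<in> {..<n} - {i}"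
    then have "cmod (R $$ (i, j)) \<le> \<rho>"
      using i by (intro off) auto
    then show "cmod (R $$ (i, j)) * cmod (v $ j) \<le> \<rho> * cmod (v $ i)"
      using i_max[of j] j by (intro mult_mono) (auto intro: order_trans[OF norm_ge_zero])
  qed
  also have "\<dots> = (real n - 1) * \<rho> * cmod (v $ i)"
    using i by (simp add: card_Diff_singleton of_nat_diff)
  finally have "cmod (1 - \<mu>) \<le> (real n - 1) * \<rho>"
    using pos by (simp add: norm_mult)
  then show ?thesis
    using complex_Re_le_cmod[of "1 - \<mu>"] by simp
qed

section \<open>Full row rank and orthogonality to the columns\<close>

lemma full_row_rank_orthogonal:
  fixes A :: "complex mat"
  assumes A: "A \<in> carrier_mat K N" and rank: "vec_space.rank K A = K"
    and w: "w \<in> carrier_vec K" and orth: "\<And>j. j < N \<Longrightarrow> col A j \<bullet>c w = 0"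
  shows "w = 0\<^sub>v K"
proof -
  interpret vec_space "TYPE(complex)" K .
  obtain S where S: "maximal S (\<lambda>T. T \<subseteq> set (cols A) \<and> lin_indpt T)" "finite S"
    using maximal_exists_superset[of "set (cols A)" "\<lambda>T. T \<subseteq> set (cols A) \<and> lin_indpt T" "{}"]
      finite_lin_indpt2 by (auto simp: lin_dep_def)
  then have sub: "S \<subseteq> set (cols A)" and indpt: "lin_indpt S"
    by (auto simp: maximal_def)
  have carr: "S \<subseteq> carrier_vec K"
    using sub cols_dim[of A] A by auto
  \<comment> \<open>The rank is the size of a maximal independent set of columns, so full row rank
    turns \<open>S\<close> into a basis of the whole space.\<close>
  have "card S = K"
    using rank_card_indpt[OF A S(1)] rank by simp
  then have "basis S"
    using carr indpt S(2) by (intro dim_li_is_basis) (auto simp: dim_is_n)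
  then have "w \<in> span S"
    using w by (simp add: basis_def)
  then obtain a where a: "w = lincomb a S"
    using finite_span[OF S(2)] carr by auto
  have "w $ i = (\<Sum>x\<in>S. a x * x $ i)" if "i < K" for i
    using lincomb_index[OF that carr, of a] a by simp
  \<comment> \<open>As a combination of columns that are all orthogonal to \<open>w\<close>, the
    vector \<open>w\<close> is orthogonal to itself.\<close>
  then have "w \<bullet>c w = (\<Sum>i<K. (\<Sum>x\<in>S. a x * x $ i) * cnj (w $ i))"
    using w unfolding scalar_prod_def atLeast0LessThan by (intro sum.cong) auto
  also have "\<dots> = (\<Sum>x\<in>S. \<Sum>i<K. a x * x $ i * cnj (w $ i))"
    unfolding sum_distrib_right by (rule sum.swap)
  also have "\<dots> = (\<Sum>x\<in>S. a x * (x \<bullet>c w))"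
    using w by (simp add: scalar_prod_def atLeast0LessThan sum_distrib_left mult.assoc)
  also have "\<dots> = 0"
  proof (rule sum.neutral, rule ballI)
    fix x
    assume "x \<in> S"
    then obtain j where "j < N" "x = col A j"
      using sub A by (auto simp: cols_def)
    then show "a x * (x \<bullet>c w) = 0"
      by (simp add: orth)
  qed
  finally show ?thesis
    using conjugate_square_eq_0_vec[OF w] by simp
qed

section \<open>Geometric sums, the digital sinc and the Gram matrix of steering vectors\<close>

lemma norm_one_minus_cis: "cmod (1 - cis (2 * x)) = 2 * \<bar>sin x\<bar>"
proof -
  have "(cmod (1 - cis (2 * x)))\<^sup>2 = (1 - cos (2 * x))\<^sup>2 + (sin (2 * x))\<^sup>2"
    by (simp add: cmod_power2)
  also have "\<dots> = 2 - 2 * cos (2 * x)"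
    using sin_cos_squared_add[of "2 * x"] by (simp add: power2_diff)
  also have "\<dots> = (2 * \<bar>sin x\<bar>)\<^sup>2"
    by (simp add: cos_double_sin power_mult_distrib)
  finally show ?thesis
    by (rule power2_eq_imp_eq) auto
qed

text \<open>A geometric sum with ratio \<open>cis (2 * x)\<close>. If \<open>sin x\<close> is
  nonzero, its modulus is a quotient of two chord lengths of the unit circle. Otherwise the ratio is
  1 and the sum is \<open>N\<close>, in agreement with the extended value of
  \<open>digital_sinc\<close>, which has modulus 1.\<close>

lemma norm_sum_cis_eq_digital_sinc:
  "cmod (\<Sum>n<N. cis (2 * real n * x)) = real N * \<bar>digital_sinc N x\<bar>"
proof -
  have pow: "cis (2 * real n * x) = cis (2 * x) ^ n" for n
    by (simp add: DeMoivre ac_simps)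
  show ?thesis
  proof (cases "sin x = 0")
    case True
    have "cmod (1 - cis (2 * x)) = 0"
      unfolding norm_one_minus_cis using True by simp
    then have "cis (2 * x) = 1"
      by simp
    moreover have "sin (real N * x) = 0"
    proof -
      obtain i :: int where "x = real_of_int i * pi"
        using True by (auto simp: sin_zero_iff_int2)
      then show ?thesis
        unfolding sin_zero_iff_int2 by (intro exI[of _ "int N * i"]) simp
    qed
    then have "\<bar>cos (real N * x)\<bar> = 1" "\<bar>cos x\<bar> = 1"
      using True sin_zero_abs_cos_one by auto
    ultimately show ?thesis
      using True by (simp add: pow digital_sinc_def)
  next
    case False
    have "(1 - cis (2 * x)) * (\<Sum>n<N. cis (2 * real n * x)) = 1 - cis (2 * (real N * x))"
      unfolding pow one_diff_power_eq[symmetric] by (simp only: pow[symmetric] mult.assoc)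
    then have "2 * \<bar>sin x\<bar> * cmod (\<Sum>n<N. cis (2 * real n * x)) = 2 * \<bar>sin (real N * x)\<bar>"
      by (metis norm_mult norm_one_minus_cis)
    then show ?thesis
      using False by (cases "N = 0") (auto simp: digital_sinc_def abs_mult abs_divide field_simps)
  qed
qed

lemma steering_mat_carrier: "steering_mat K N d wl \<theta> \<in> carrier_mat K N"
  using mat_of_rows_carrier(1)[of N "map (\<lambda>i. steering_vec N d wl (\<theta> i)) [0..<K]"]
  by (simp add: steering_mat_def)

lemma index_steering_mat:
  assumes "i < K" "n < N"
  shows "steering_mat K N d wl \<theta> $$ (i, n) = cis (- (real n * (2 * pi * d / wl) * sin (\<theta> i)))"
  using assms by (simp add: steering_mat_def mat_of_rows_index steering_vec_def cis_conv_exp)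

text \<open>The entry is the conjugate of a geometric sum, the exponents of steering vectors being
  negative. The phase step \<open>2 * pi * d / wl\<close> is twice the factor in the argument of
  \<open>digital_sinc\<close>, matching the ratio \<open>cis (2 * x)\<close>.\<close>

lemma norm_gram_steering_mat:
  fixes K N :: nat and d wl :: real and \<theta> :: "nat \<Rightarrow> real"
  defines "A \<equiv> steering_mat K N d wl \<theta>"
  assumes "i < K" "j < K"
  shows "cmod ((A * mat_adjoint A) $$ (i, j)) =
    real N * \<bar>digital_sinc N (pi * d / wl * (sin (\<theta> i) - sin (\<theta> j)))\<bar>"
proof -
  define x where "x = pi * d / wl * (sin (\<theta> i) - sin (\<theta> j))"
  have A: "A \<in> carrier_mat K N"
    by (simp add: A_def steering_mat_carrier)
  have "(A * mat_adjoint A) $$ (i, j) = (\<Sum>n<N. A $$ (i, n) * cnj (A $$ (j, n)))"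
    using A assms(2,3)
    by (auto simp: scalar_prod_def atLeast0LessThan index_mat_adjoint intro!: sum.cong)
  also have "\<dots> = (\<Sum>n<N. cnj (cis (2 * real n * x)))"
    using assms(2,3)
    by (intro sum.cong) (auto simp: A_def index_steering_mat cis_cnj cis_mult x_def algebra_simps)
  also have "\<dots> = cnj (\<Sum>n<N. cis (2 * real n * x))"
    by (simp only: cnj_sum)
  finally show ?thesis
    using norm_sum_cis_eq_digital_sinc[of x N] by (simp only: complex_mod_cnj x_def)
qed

lemma gram_diag_steering_mat:
  fixes K N :: nat and d wl :: real and \<theta> :: "nat \<Rightarrow> real"
  defines "A \<equiv> steering_mat K N d wl \<theta>"
  assumes "i < K"
  shows "(A * mat_adjoint A) $$ (i, i) = of_nat N"
proof -
  have A: "A \<in> carrier_mat K N"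
    by (simp add: A_def steering_mat_carrier)
  have "(A * mat_adjoint A) $$ (i, i) = (\<Sum>n<N. A $$ (i, n) * cnj (A $$ (i, n)))"
    using A assms(2)
    by (auto simp: scalar_prod_def atLeast0LessThan index_mat_adjoint intro!: sum.cong)
  also have "\<dots> = (\<Sum>n<N. 1)"
    using assms(2) by (intro sum.cong) (auto simp: A_def index_steering_mat cis_cnj cis_mult)
  finally show ?thesis
    by simp
qed

lemma mat_adjoint_mult_self:
  fixes A :: "complex mat"
  assumes A: "A \<in> carrier_mat m n"
  shows "mat_adjoint (A * mat_adjoint A) = A * mat_adjoint A"
proof (rule eq_matI)
  fix i j
  assume "i < dim_row (A * mat_adjoint A)" "j < dim_col (A * mat_adjoint A)"
  then show "mat_adjoint (A * mat_adjoint A) $$ (i, j) = (A * mat_adjoint A) $$ (i, j)"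
    using A by (auto simp: index_mat_adjoint scalar_prod_def cnj_sum ac_simps intro!: sum.cong)
qed auto

lemma mat_adjoint_smult_real:
  fixes A :: "complex mat"
  assumes A: "A \<in> carrier_mat n n" "mat_adjoint A = A"
  shows "mat_adjoint (complex_of_real c \<cdot>\<^sub>m A) = complex_of_real c \<cdot>\<^sub>m A"
proof (rule eq_matI)
  fix i j
  assume "i < dim_row (complex_of_real c \<cdot>\<^sub>m A)" "j < dim_col (complex_of_real c \<cdot>\<^sub>m A)"
  then show "mat_adjoint (complex_of_real c \<cdot>\<^sub>m A) $$ (i, j) = (complex_of_real c \<cdot>\<^sub>m A) $$ (i, j)"
    using A index_mat_adjoint[of i A j] by (auto simp: index_mat_adjoint)
qed (use A in auto)

section \<open>The IQ norm, and the diagonal bound on \<open>lambda_min\<close>\<close>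

lemma iq_norm_ge:
  assumes "n < dim_vec x"
  shows "\<bar>Re (x $ n)\<bar> \<le> iq_norm x" "\<bar>Im (x $ n)\<bar> \<le> iq_norm x"
  unfolding iq_norm_def using assms by (intro Max_ge; auto)+

lemma iq_norm_pos:
  assumes "x \<in> carrier_vec n" "x \<noteq> 0\<^sub>v n"
  shows "iq_norm x > 0"
proof -
  obtain i where "i < n" "x $ i \<noteq> 0"
    using assms by (metis carrier_vecD eq_vecI index_zero_vec)
  then have "\<bar>Re (x $ i)\<bar> > 0 \<or> \<bar>Im (x $ i)\<bar> > 0"
    by (auto simp: complex_eq_iff)
  then show ?thesis
    using iq_norm_ge[of i x] \<open>i < n\<close> assms(1) by auto
qed

lemma iq_norm_le:
  assumes "dim_vec x > 0" "\<And>n. n < dim_vec x \<Longrightarrow> cmod (x $ n) \<le> b"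
  shows "iq_norm x \<le> b"
  unfolding iq_norm_def
  using assms by (subst Max_le_iff) (auto intro: order_trans[OF abs_Re_le_cmod] order_trans[OF abs_Im_le_cmod])

text \<open>A diagonal entry is the Rayleigh quotient of a standard basis vector.\<close>

lemma lambda_min_le_diagonal:
  fixes R :: "complex mat"
  assumes R: "R \<in> carrier_mat n n" "mat_adjoint R = R" and i: "i < n"
  shows "lambda_min R \<le> Re (R $$ (i, i))"
proof -
  define e where "e = (unit_vec n i :: complex vec)"
  have e: "e \<in> carrier_vec n" "conjugate e = e"
    using i by (auto simp: e_def unit_vec_def)
  have "complex_of_real (vnorm2 e) = e \<bullet> e"
    using e(2) cscalar_prod_self[of e] by simp
  also have "\<dots> = 1"
    using i by (simp add: e_def)
  finally have 1: "vnorm2 e = 1"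
    by simp
  have "(R *\<^sub>v e) \<bullet>c e = (R *\<^sub>v e) $ i"
    unfolding e(2) using R(1) i by (simp add: e_def)
  also have "\<dots> = R $$ (i, i)"
    using R(1) i by (simp add: e_def)
  finally show ?thesis
    using lambda_min_rayleigh[OF R _ e(1)] i 1 by simp
qed

section \<open>The Gram matrix and the pseudoinverse\<close>

lemma gram_form:
  fixes A :: "complex mat"
  assumes A: "A \<in> carrier_mat m n" and v: "v \<in> carrier_vec m"
  shows "((A * mat_adjoint A) *\<^sub>v v) \<bullet>c v = complex_of_real (vnorm2 (mat_adjoint A *\<^sub>v v))"
proof -
  have "mat_adjoint A *\<^sub>v v \<in> carrier_vec n"
    using mat_adjoint_carrier[OF A] v by simp
  then show ?thesis
    using cscalar_prod_adjoint[OF A _ v] assoc_mult_mat_vec[OF A mat_adjoint_carrier[OF A] v]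
    by (simp add: cscalar_prod_self)
qed

text \<open>By \<open>gram_form\<close>, a kernel vector of the Gram matrix is also killed by
  \<open>mat_adjoint A\<close>. It is then orthogonal to all columns of \<open>A\<close>, which full
  row rank excludes for nonzero vectors.\<close>

lemma det_gram_nonzero:
  fixes A :: "complex mat"
  assumes A: "A \<in> carrier_mat K N" and rank: "vec_space.rank K A = K"
  shows "det (A * mat_adjoint A) \<noteq> 0"
proof
  assume "det (A * mat_adjoint A) = 0"
  then obtain v where v: "v \<in> carrier_vec K" "v \<noteq> 0\<^sub>v K" "(A * mat_adjoint A) *\<^sub>v v = 0\<^sub>v K"
    using det_0_iff_vec_prod_zero_field[OF mult_carrier_mat[OF A mat_adjoint_carrier[OF A]]] by blast
  have "vnorm2 (mat_adjoint A *\<^sub>v v) = 0"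
    using gram_form[OF A v(1)] v(1,3) by simp
  then have 0: "mat_adjoint A *\<^sub>v v = 0\<^sub>v N"
    using vnorm2_eq_0_iff[OF mult_mat_vec_carrier[OF mat_adjoint_carrier[OF A] v(1)]] by simp
  have "col A j \<bullet>c v = 0" if j: "j < N" for j
  proof -
    have "col A j \<bullet>c v = cnj ((mat_adjoint A *\<^sub>v v) $ j)"
      using A v(1) j by (simp add: scalar_prod_def index_mat_adjoint cnj_sum)
    then show ?thesis
      using 0 j by simp
  qed
  then show False
    using full_row_rank_orthogonal[OF A rank v(1)] v(2) by blast
qed

text \<open>Eliminates the inverse: afterwards \<open>w\<close> is known only through the linear
  system that it solves, which suits the bound by \<open>lambda_min\<close>.\<close>

lemma right_pinv_mult_vec:
  assumes A: "A \<in> carrier_mat K N" and rank: "vec_space.rank K A = K" and z: "z \<in> carrier_vec K"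
  obtains w where "w \<in> carrier_vec K" "right_pinv A *\<^sub>v z = mat_adjoint A *\<^sub>v w"
    "(A * mat_adjoint A) *\<^sub>v w = z"
proof -
  have G: "A * mat_adjoint A \<in> carrier_mat K K"
    using A mat_adjoint_carrier[OF A] by simp
  obtain B where B: "mat_inverse (A * mat_adjoint A) = Some B" "B \<in> carrier_mat K K"
      "(A * mat_adjoint A) * B = 1\<^sub>m K"
    using det_nonzero_inverse[OF G det_gram_nonzero[OF A rank]] by metis
  show thesis
  proof
    show "B *\<^sub>v z \<in> carrier_vec K"
      using B(2) z by simp
    show "right_pinv A *\<^sub>v z = mat_adjoint A *\<^sub>v (B *\<^sub>v z)"
      using assoc_mult_mat_vec[OF mat_adjoint_carrier[OF A] B(2) z] B(1) by (simp add: right_pinv_def)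
    show "(A * mat_adjoint A) *\<^sub>v (B *\<^sub>v z) = z"
      using assoc_mult_mat_vec[OF G B(2) z] B(3) z by simp
  qed
qed

text \<open>Cauchy--Schwarz in each row of \<open>mat_adjoint A\<close>, whose squared norm is at
  most \<open>K\<close>; real and imaginary parts are bounded by the modulus.\<close>

lemma iq_norm_adjoint_mult_le:
  fixes A :: "complex mat"
  assumes A: "A \<in> carrier_mat K N" and "N > 0" and w: "w \<in> carrier_vec K"
    and entry: "\<And>i n. i < K \<Longrightarrow> n < N \<Longrightarrow> cmod (A $$ (i, n)) \<le> 1"
  shows "iq_norm (mat_adjoint A *\<^sub>v w) \<le> sqrt (real K * vnorm2 w)"
proof (rule iq_norm_le)
  show "dim_vec (mat_adjoint A *\<^sub>v w) > 0"
    using A \<open>N > 0\<close> by simp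
  fix n
  assume "n < dim_vec (mat_adjoint A *\<^sub>v w)"
  then have n: "n < N"
    using A by simp
  have "vnorm2 (row (mat_adjoint A) n) = (\<Sum>i<K. (cmod (A $$ (i, n)))\<^sup>2)"
    using A n by (simp add: vnorm2_def index_mat_adjoint)
  also have "\<dots> \<le> (\<Sum>i<K. 1)"
    using entry n by (intro sum_mono power_le_one) auto
  finally have row: "vnorm2 (row (mat_adjoint A) n) \<le> real K"
    by simp
  have "(cmod ((mat_adjoint A *\<^sub>v w) $ n))\<^sup>2 = (cmod (row (mat_adjoint A) n \<bullet> w))\<^sup>2"
    using A n by simp
  also have "\<dots> \<le> vnorm2 (row (mat_adjoint A) n) * vnorm2 w"
    using A w by (intro cmod_scalar_prod_le) auto
  also have "\<dots> \<le> real K * vnorm2 w"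
    using row by (intro mult_right_mono) auto
  finally show "cmod ((mat_adjoint A *\<^sub>v w) $ n) \<le> sqrt (real K * vnorm2 w)"
    by (rule real_le_rsqrt)
qed

theorem proposition1:
  fixes N K M k :: nat
    and P d wl \<sigma>v \<phi> \<gamma> \<rho> :: real
    and \<alpha> :: "nat \<Rightarrow> complex"
    and \<theta> \<sigma>w SNR :: "nat \<Rightarrow> real"
    and s :: "complex vec"
    and A D R :: "complex mat"
  assumes "N \<ge> 1" and "K \<ge> 1"
    and "P > 0" and "\<sigma>v\<^sup>2 > 0" and "wl > 0" and "0 < d" and "d \<le> wl / 2"
    and "\<And>i. i < K \<Longrightarrow> \<alpha> i \<noteq> 0"
    and "\<And>i. i < K \<Longrightarrow> \<theta> i \<in> {- pi / 2 .. pi / 2}"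
    and "s \<in> carrier_vec K" and "\<And>i. i < K \<Longrightarrow> s $ i \<in> psk M \<phi>"
    and "A = steering_mat K N d wl \<theta>"
    and "vec_space.rank K A = K"
    and "\<And>i. i < K \<Longrightarrow>
           (\<sigma>w i)\<^sup>2 = 4 * (cmod (\<alpha> i))\<^sup>2 * P / 3 * \<bar>sin (pi * d / wl * sin (\<theta> i))\<bar>\<^sup>2 + \<sigma>v\<^sup>2"
    and "\<And>i. i < K \<Longrightarrow> \<sigma>w i > 0"
    and "D = mat_diag K (\<lambda>i. complex_of_real (\<sigma>w i) * cnj (\<alpha> i) / complex_of_real ((cmod (\<alpha> i))\<^sup>2))"
    and "\<gamma> = 1 / iq_norm ((right_pinv A * D) *\<^sub>v s)"
    and "\<And>i. i < K \<Longrightarrow> SNR i = P / (2 * real N) * \<gamma>\<^sup>2"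
    and "is_arg_max (\<lambda>i. \<sigma>w i / cmod (\<alpha> i)) (\<lambda>i. i < K) k"
    and "R = (1 / complex_of_nat N) \<cdot>\<^sub>m (A * mat_adjoint A)"
    and "\<rho> = (if K = 1 then 0
               else Max {\<bar>digital_sinc N (pi * d / wl * (sin (\<theta> i) - sin (\<theta> j)))\<bar> | i j.
                          i < K \<and> j < K \<and> i \<noteq> j})"
  shows "(\<forall>i<K. SNR i \<ge> P * real N * (cmod (\<alpha> k))\<^sup>2 * (lambda_min R)\<^sup>2
                          / (2 * real K ^ 3 * (\<sigma>w k)\<^sup>2))
       \<and> P * real N * (cmod (\<alpha> k))\<^sup>2 * (lambda_min R)\<^sup>2 / (2 * real K ^ 3 * (\<sigma>w k)\<^sup>2)
         = P * real N * (cmod (\<alpha> k))\<^sup>2 * (lambda_min R)\<^sup>2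
             / (2 * real K ^ 3 *
                (4 * (cmod (\<alpha> k))\<^sup>2 * P / 3 * \<bar>sin (pi * d / wl * sin (\<theta> k))\<bar>\<^sup>2 + \<sigma>v\<^sup>2))
       \<and> 1 \<ge> lambda_min R
       \<and> lambda_min R \<ge> 1 - (real K - 1) * \<rho>"
proof -
  have N: "N > 0" and K: "K > 0"
    using assms(1,2) by auto
  have k: "k < K" and k_max: "\<And>i. i < K \<Longrightarrow> \<sigma>w i / cmod (\<alpha> i) \<le> \<sigma>w k / cmod (\<alpha> k)"
    using assms(19) by (auto simp: is_arg_max_linorder)
  \<comment> \<open>The largest modulus of an entry of the vector \<open>z\<close> below.\<close>
  define c where "c = \<sigma>w k / cmod (\<alpha> k)"
  have c: "c > 0"
    using assms(8,15) k by (simp add: c_def)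
  have A: "A \<in> carrier_mat K N"
    by (simp add: assms(12) steering_mat_carrier)
  define G where "G = A * mat_adjoint A"
  have G: "G \<in> carrier_mat K K"
    unfolding G_def using A mat_adjoint_carrier[OF A] by simp
  have R_eq: "R = complex_of_real (1 / real N) \<cdot>\<^sub>m G"
    by (simp add: assms(20) G_def)
  have R: "R \<in> carrier_mat K K"
    using G by (simp add: R_eq)
  have R_herm: "mat_adjoint R = R"
    unfolding R_eq using G mat_adjoint_mult_self[OF A] by (intro mat_adjoint_smult_real) (auto simp: G_def)
  have R_vec: "R *\<^sub>v v = complex_of_real (1 / real N) \<cdot>\<^sub>v (G *\<^sub>v v)" if "v \<in> carrier_vec K" for v
    unfolding R_eq using that G by (intro eq_vecI) auto
  have diag: "R $$ (i, i) = 1" if "i < K" for i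
  proof -
    have "R $$ (i, i) = complex_of_real (1 / real N) * G $$ (i, i)"
      using that G by (simp add: R_eq)
    then show ?thesis
      using N gram_diag_steering_mat[OF that, of N d wl \<theta>] by (simp add: G_def assms(12))
  qed

  \<comment> \<open>\<open>R\<close> is a Gram matrix divided by \<open>N\<close>, so an eigenvalue
    times \<open>vnorm2 v\<close> is the scaled squared norm of
    \<open>mat_adjoint A *\<^sub>v v\<close>.\<close>
  have nonneg: "0 \<le> lambda_min R"
  proof -
    obtain \<mu> where \<mu>: "eigenvalue R \<mu>" "lambda_min R = Re \<mu>"
      using lambda_min_eigenvalue[OF R K] .
    then obtain v where v: "v \<in> carrier_vec K" "v \<noteq> 0\<^sub>v K" "R *\<^sub>v v = \<mu> \<cdot>\<^sub>v v"
      using R unfolding eigenvalue_def eigenvector_def by auto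
    have "\<mu> * complex_of_real (vnorm2 v) = (R *\<^sub>v v) \<bullet>c v"
      using v by (simp add: cscalar_prod_self)
    also have "\<dots> = complex_of_real (1 / real N) * ((G *\<^sub>v v) \<bullet>c v)"
      unfolding R_vec[OF v(1)] using G v(1) by simp
    also have "\<dots> = complex_of_real (vnorm2 (mat_adjoint A *\<^sub>v v) / real N)"
      unfolding G_def gram_form[OF A v(1)] by simp
    finally have "Re (\<mu> * complex_of_real (vnorm2 v)) = vnorm2 (mat_adjoint A *\<^sub>v v) / real N"
      by simp
    then have "0 \<le> Re \<mu> * vnorm2 v"
      by simp
    moreover have "vnorm2 v > 0"
      using vnorm2_eq_0_iff[OF v(1)] v(2) vnorm2_nonneg[of v] by linarith
    ultimately show ?thesis
      by (simp add: \<mu>(2) zero_le_mult_iff)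
  qed

  define z where "z = D *\<^sub>v s"
  have D: "D \<in> carrier_mat K K"
    by (simp add: assms(16))
  have z: "z \<in> carrier_vec K"
    using D assms(10) by (simp add: z_def)
  \<comment> \<open>The PSK symbol has modulus 1, and the conjugate of \<open>\<alpha> i\<close>
    cancels one of the two factors in the denominator.\<close>
  have z_cmod: "cmod (z $ i) = \<sigma>w i / cmod (\<alpha> i)" if i: "i < K" for i
  proof -
    have "z $ i = complex_of_real (\<sigma>w i) * cnj (\<alpha> i) / complex_of_real ((cmod (\<alpha> i))\<^sup>2) * s $ i"
      using i assms(10)
      by (simp add: z_def assms(16) mat_diag_def scalar_prod_def if_distrib[of "\<lambda>t. t * _"] cong: if_cong)
    moreover have "cmod (s $ i) = 1"
      using assms(11)[OF i] by (auto simp: psk_def)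
    ultimately show ?thesis
      using assms(8,15)[OF i] by (simp add: norm_mult norm_divide norm_power power2_eq_square)
  qed
  have "vnorm2 z = (\<Sum>i<K. (\<sigma>w i / cmod (\<alpha> i))\<^sup>2)"
    using z by (simp add: vnorm2_def z_cmod)
  also have "\<dots> \<le> (\<Sum>i<K. c\<^sup>2)"
    unfolding c_def using k_max assms(15) by (intro sum_mono power_mono) (auto simp: less_imp_le)
  finally have z_le: "vnorm2 z \<le> real K * c\<^sup>2"
    by simp

  obtain w where w: "w \<in> carrier_vec K" "right_pinv A *\<^sub>v z = mat_adjoint A *\<^sub>v w" "G *\<^sub>v w = z"
    using right_pinv_mult_vec[OF A assms(13) z] unfolding G_def by metis
  define u where "u = mat_adjoint A *\<^sub>v w"
  have u: "u \<in> carrier_vec N"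
    unfolding u_def using mat_adjoint_carrier[OF A] w(1) by simp
  \<comment> \<open>The zero-forcing property. With \<open>z\<close> nonzero it forces
    \<open>u\<close> to be nonzero, so that \<open>\<gamma>\<close> is a genuine reciprocal and not
    the default value 0 of a division by zero.\<close>
  have "A *\<^sub>v u = z"
    using w(3) assoc_mult_mat_vec[OF A mat_adjoint_carrier[OF A] w(1)] by (simp add: u_def G_def)
  moreover have "z $ k \<noteq> 0"
    using z_cmod[OF k] c by (auto simp: c_def)
  ultimately have "u \<noteq> 0\<^sub>v N"
    using A k by auto
  with u have iq_pos: "iq_norm u > 0"
    by (rule iq_norm_pos)
  \<comment> \<open>Associativity needs these dimensions, which follow from the existence of the
    inverse.\<close>
  have "right_pinv A \<in> carrier_mat N K"
    using det_nonzero_inverse[OF G] det_gram_nonzero[OF A assms(13)] mat_adjoint_carrier[OF A]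
    unfolding right_pinv_def G_def by (metis mult_carrier_mat option.sel)
  then have "(right_pinv A * D) *\<^sub>v s = u"
    using assoc_mult_mat_vec[OF _ D assms(10)] w(2) by (simp add: z_def u_def)
  then have \<gamma>: "\<gamma>\<^sup>2 = 1 / (iq_norm u)\<^sup>2"
    by (simp add: assms(17) power_divide)

  have "(lambda_min R)\<^sup>2 * vnorm2 w \<le> vnorm2 (R *\<^sub>v w)"
    using lambda_min_mult_vnorm2_le[OF R R_herm K w(1) nonneg] .
  \<comment> \<open>Since \<open>G\<close> maps \<open>w\<close> to \<open>z\<close>, the matrix
    \<open>R\<close> maps it to \<open>z\<close> divided by \<open>N\<close>.\<close>
  also have "\<dots> = vnorm2 z / (real N)\<^sup>2"
    unfolding R_vec[OF w(1)] w(3)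
    by (simp add: vnorm2_def norm_mult norm_divide power_divide sum_divide_distrib)
  also have "\<dots> \<le> real K * c\<^sup>2 / (real N)\<^sup>2"
    using z_le by (intro divide_right_mono) auto
  finally have w_le: "(real N)\<^sup>2 * (lambda_min R)\<^sup>2 * vnorm2 w \<le> real K * c\<^sup>2"
    using N by (simp add: field_simps)
  have "iq_norm u \<le> sqrt (real K * vnorm2 w)"
    unfolding u_def using w(1) N
    by (intro iq_norm_adjoint_mult_le[OF A]) (auto simp: assms(12) index_steering_mat)
  then have "(iq_norm u)\<^sup>2 \<le> (sqrt (real K * vnorm2 w))\<^sup>2"
    using iq_pos by (intro power_mono) auto
  then have "(iq_norm u)\<^sup>2 \<le> real K * vnorm2 w"
    by simp
  then have "(real N)\<^sup>2 * (lambda_min R)\<^sup>2 * (iq_norm u)\<^sup>2 \<le>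
      (real N)\<^sup>2 * (lambda_min R)\<^sup>2 * (real K * vnorm2 w)"
    by (intro mult_left_mono) auto
  also have "\<dots> \<le> real K * (real K * c\<^sup>2)"
    using mult_left_mono[OF w_le, of "real K"] by (simp add: ac_simps)
  \<comment> \<open>Weakens the factor \<open>K^2\<close> to the stated \<open>K^3\<close>, using
    \<open>K \<ge> 1\<close>.\<close>
  also have "\<dots> \<le> real K * (real K * (real K * c\<^sup>2))"
    using K mult_right_mono[of 1 "real K" "c\<^sup>2"] by (intro mult_left_mono) auto
  also have "\<dots> = real K ^ 3 * c\<^sup>2"
    by (simp add: power3_eq_cube)
  finally have main: "(real N)\<^sup>2 * (lambda_min R)\<^sup>2 / (real K ^ 3 * c\<^sup>2) \<le> \<gamma>\<^sup>2"
    using iq_pos K c by (simp add: \<gamma> field_simps)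
  have "P * real N * (cmod (\<alpha> k))\<^sup>2 * (lambda_min R)\<^sup>2 / (2 * real K ^ 3 * (\<sigma>w k)\<^sup>2) =
      P / (2 * real N) * ((real N)\<^sup>2 * (lambda_min R)\<^sup>2 / (real K ^ 3 * c\<^sup>2))"
    using N K assms(8)[OF k] assms(15)[OF k]
    by (simp add: c_def power_divide field_simps power2_eq_square)
  also have "\<dots> \<le> P / (2 * real N) * \<gamma>\<^sup>2"
    using main assms(3) by (intro mult_left_mono) auto
  finally have snr: "SNR i \<ge> P * real N * (cmod (\<alpha> k))\<^sup>2 * (lambda_min R)\<^sup>2 / (2 * real K ^ 3 * (\<sigma>w k)\<^sup>2)"
    if "i < K" for i
    using assms(18)[OF that] by simp

  have "lambda_min R \<le> 1"
    using lambda_min_le_diagonal[OF R R_herm K] diag[OF K] by simp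
  moreover have "1 - (real K - 1) * \<rho> \<le> lambda_min R"
  proof -
    define f where "f i j = \<bar>digital_sinc N (pi * d / wl * (sin (\<theta> i) - sin (\<theta> j)))\<bar>" for i j
    have off: "cmod (R $$ (i, j)) \<le> \<rho>" if ij: "i < K" "j < K" "i \<noteq> j" for i j
    proof -
      have "cmod (R $$ (i, j)) = cmod (G $$ (i, j)) / real N"
        using ij G by (simp add: R_eq norm_mult norm_divide)
      also have "\<dots> = f i j"
        using norm_gram_steering_mat[OF ij(1,2), of N d wl \<theta>] N by (simp add: G_def assms(12) f_def)
      also have "f i j \<le> Max {f i j | i j. i < K \<and> j < K \<and> i \<noteq> j}"
      proof (rule Max_ge)
        have "{f i j | i j. i < K \<and> j < K \<and> i \<noteq> j} \<subseteq> (\<lambda>(i, j). f i j) ` ({..<K} \<times> {..<K})"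
          by auto
        then show "finite {f i j | i j. i < K \<and> j < K \<and> i \<noteq> j}"
          by (rule finite_subset) simp
      qed (use ij in blast)
      \<comment> \<open>Two distinct indices below \<open>K\<close> rule out \<open>K = 1\<close>,
        so \<open>\<rho>\<close> is the maximum here.\<close>
      also have "\<dots> = \<rho>"
        using ij by (auto simp: assms(21) f_def)
      finally show ?thesis .
    qed
    obtain \<mu> where "eigenvalue R \<mu>" "lambda_min R = Re \<mu>"
      using lambda_min_eigenvalue[OF R K] .
    then show ?thesis
      using eigenvalue_ge_of_unit_diagonal[OF R _ diag off] by simp
  qed
  ultimately show ?thesis
    using snr assms(14)[OF k] by simp
qed

end
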